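(* Let $n\geqslant 1$. The map $(T,e)\mapsto \mathrm{insertion}(T,e)$ is a bijection from the set of pairs $(T,e)$, where $T$ is a staircase tableau of size $n$ and $e$ is an element of $\{\alpha,\beta,\gamma,\delta\}\cup\{(x,y,i)\mid x\in\{\alpha,\gamma\},\ y\in\{\beta,\delta\},\ i\in\{1,\dots,n\}\}$, onto the set of staircase tableaux of size $n+1$.
   Context: Staircase tableaux. For $n\geqslant 1$, the staircase shape of size $n$ is the set of cells $(i,j)$ with $1\leqslant j\leqslant i\leqslant n$ ($i$ = row, $j$ = column), rows numbered from bottom to top and columns from left to right; thus row $i$ consists of $(i,1),\dots,(i,i)$ (the top row $n$ is the longest), column $j$ consists of $(j,j),(j+1,j),\dots,(n,j)$ from bottom to top, and the diagonal cells are $c_i=(i,i)$. A staircase tableau of size $n$ is a filling of this shape in which every cell is either empty or labelled by one of the symbols $\alpha,\beta,\gamma,\delta$, such that: every diagonal cell $c_i$ is labelled; if a cell $(i,j)$ is labelled $\alpha$ or $\gamma$, then all cells $(i',j)$ with $i'>i$ (above it in its column) are empty; if a cell $(i,j)$ is labelled $\beta$ or $\delta$, then all cells $(i,j')$ with $j'<j$ (to its left in its row) are empty. Row $i$ is "of type $\alpha/\gamma$" if $c_i$ is labelled $\alpha$ or $\gamma$. Elementary operations. For rows $i_1<i_2$: if all cells of row $i_2$ are empty, the operation $L_{i_1}\to L_{i_2}$ moves the content of cell $(i_1,k)$ to cell $(i_2,k)$ for every $1\leqslant k\leqslant i_1$ (leaving $(i_1,k)$ empty); if all cells of row $i_2$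 except $c_{i_2}$ are empty, the operation $L^*_{i_1}\to L_{i_2}$ does the same for every $1\leqslant k<i_1$ only. Insertion. Let $T$ be a staircase tableau of size $n$. Adding a row $L_{n+1}(z)$ means adding above $T$ a new row $n+1$ of cells $(n+1,1),\dots,(n+1,n+1)$, all empty except $c_{n+1}$, which is labelled $z$. (1) For $y\in\{\beta,\delta\}$: $\mathrm{insertion}(T,y)$ is $T$ with the row $L_{n+1}(y)$ added. (2) For $x\in\{\alpha,\gamma\}$: add the row $L_{n+1}(x)$; let $i_1<\dots<i_k=n+1$ be the indices of all rows of type $\alpha/\gamma$ of the resulting array; perform successively $L^*_{i_{k-1}}\to L_{i_k}$, then $L^*_{i_{k-2}}\to L_{i_{k-1}}$, ..., then $L^*_{i_1}\to L_{i_2}$. The result is $\mathrm{insertion}(T,x)$. (3) For $x\in\{\alpha,\gamma\}$, $y\in\{\beta,\delta\}$, $i\in\{1,\dots,n\}$: add the row $L_{n+1}(x)$; let $i<i_l<\dots<i_k=n+1$ be the indices of the rows of type $\alpha/\gamma$ that are strictly above row $i$; perform successively $L^*_{i_{k-1}}\to L_{i_k}$, ..., $L^*_{i_l}\to L_{i_{l+1}}$ (nothing if $l=k$); then perform $L_i\to L_{i_l}$; finally label the (now empty) cell $c_i$ with $y$. The result is $\mathrm{insertion}(T,(x,y,i))$.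
   Formalization: The operation L_{i1}→L_{i2} is allowed when all cells of row i2 except c_{i2} are empty; the stated condition that all cells of row i2 are empty always fails in case (3), where c_{i_l} is labelled α or γ. *)

theory Defs
  imports Main
begin

datatype label = Alpha | Beta | Gamma | Delta

type_synonym filling = "nat \<times> nat \<rightharpoonup> label"

definition staircase :: "nat \<Rightarrow> (nat \<times> nat) set" where
  "staircase n = {(i, j). 1 \<le> j \<and> j \<le> i \<and> i \<le> n}"

text \<open>
  A cell \<open>(i, j)\<close> lies in row \<open>i\<close> (rows are numbered from bottom to top) and column \<open>j\<close>.
  The value \<^const>\<open>None\<close> means an empty cell; requiring it outside the shape makes the
  representation of a filling unique.
\<close>

definition staircase_tableaux :: "nat \<Rightarrow> filling set" where
  "staircase_tableaux n = {T. dom T \<subseteq> staircase n \<and>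
     (\<forall>i\<in>{1..n}. T (i, i) \<noteq> None) \<and>
     (\<forall>(i, j)\<in>staircase n. T (i, j) \<in> {Some Alpha, Some Gamma} \<longrightarrow>
        (\<forall>i'. i < i' \<and> i' \<le> n \<longrightarrow> T (i', j) = None)) \<and>
     (\<forall>(i, j)\<in>staircase n. T (i, j) \<in> {Some Beta, Some Delta} \<longrightarrow>
        (\<forall>j'. 1 \<le> j' \<and> j' < j \<longrightarrow> T (i, j') = None))}"

definition move_cells :: "nat set \<Rightarrow> nat \<Rightarrow> nat \<Rightarrow> filling \<Rightarrow> filling" where
  "move_cells K i\<^sub>1 i\<^sub>2 T = (\<lambda>(r, k).
     if k \<in> K \<and> r = i\<^sub>2 then T (i\<^sub>1, k)
     else if k \<in> K \<and> r = i\<^sub>1 then None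
     else T (r, k))"

definition empty_off_diagonal :: "filling \<Rightarrow> nat \<Rightarrow> bool" where
  "empty_off_diagonal T i \<longleftrightarrow> (\<forall>k\<in>{1..<i}. T (i, k) = None)"

text \<open>
  The operations \<open>L\<^bsub>i\<^sub>1\<^esub> \<rightarrow> L\<^bsub>i\<^sub>2\<^esub>\<close> and \<open>L\<^sup>*\<^bsub>i\<^sub>1\<^esub> \<rightarrow> L\<^bsub>i\<^sub>2\<^esub>\<close>. They are partial, hence
  \<^const>\<open>undefined\<close> if their precondition fails. For both of them the diagonal cell of the
  target row is allowed to be labelled: it receives nothing, as \<open>i\<^sub>1 < i\<^sub>2\<close>, and when
  \<open>L\<^bsub>i\<^sub>1\<^esub> \<rightarrow> L\<^bsub>i\<^sub>2\<^esub>\<close> is used in an insertion, that cell carries a label (which it keeps).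
\<close>

definition move_row :: "nat \<Rightarrow> nat \<Rightarrow> filling \<Rightarrow> filling" where
  "move_row i\<^sub>1 i\<^sub>2 T =
     (if i\<^sub>1 < i\<^sub>2 \<and> empty_off_diagonal T i\<^sub>2 then move_cells {1..i\<^sub>1} i\<^sub>1 i\<^sub>2 T else undefined)"

definition move_row_star :: "nat \<Rightarrow> nat \<Rightarrow> filling \<Rightarrow> filling" where
  "move_row_star i\<^sub>1 i\<^sub>2 T =
     (if i\<^sub>1 < i\<^sub>2 \<and> empty_off_diagonal T i\<^sub>2 then move_cells {1..<i\<^sub>1} i\<^sub>1 i\<^sub>2 T else undefined)"

text \<open>
  The argument list is meant to be decreasing: for \<open>[i\<^sub>k, \<dots>, i\<^sub>l]\<close> the operations
  \<open>L\<^sup>*\<^bsub>i\<^sub>k\<^sub>-\<^sub>1\<^esub> \<rightarrow> L\<^bsub>i\<^sub>k\<^esub>\<close>, \dots, \<open>L\<^sup>*\<^bsub>i\<^sub>l\<^esub> \<rightarrow> L\<^bsub>i\<^sub>l\<^sub>+\<^sub>1\<^esub>\<close> are performed in this order.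
\<close>

fun shift_rows :: "nat list \<Rightarrow> filling \<Rightarrow> filling" where
  "shift_rows (i\<^sub>2 # i\<^sub>1 # rs) T = shift_rows (i\<^sub>1 # rs) (move_row_star i\<^sub>1 i\<^sub>2 T)"
| "shift_rows _ T = T"

text \<open>The indices, in increasing order, of the rows of type \<open>\<alpha>/\<gamma>\<close> among \<open>i + 1, \<dots>, m\<close>.\<close>

definition ag_rows :: "filling \<Rightarrow> nat \<Rightarrow> nat \<Rightarrow> nat list" where
  "ag_rows T i m = filter (\<lambda>r. T (r, r) \<in> {Some Alpha, Some Gamma}) [i + 1..<m + 1]"

text \<open>Since \<open>T\<close> is empty outside the shape of size \<open>n\<close>, only the new diagonal cell needs updating.\<close>

definition add_row :: "nat \<Rightarrow> filling \<Rightarrow> label \<Rightarrow> filling" where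
  "add_row n T z = T((n + 1, n + 1) \<mapsto> z)"

datatype elt = Single label | Triple label label nat

definition insertion_elts :: "nat \<Rightarrow> elt set" where
  "insertion_elts n = {Single z | z. z \<in> {Alpha, Beta, Gamma, Delta}} \<union>
     {Triple x y i | x y i. x \<in> {Alpha, Gamma} \<and> y \<in> {Beta, Delta} \<and> i \<in> {1..n}}"

fun insertion :: "nat \<Rightarrow> filling \<Rightarrow> elt \<Rightarrow> filling" where
  "insertion n T (Single z) =
     (let T' = add_row n T z
      in if z \<in> {Beta, Delta} then T' else shift_rows (rev (ag_rows T' 0 (n + 1))) T')"
| "insertion n T (Triple x y i) =
     (let T' = add_row n T x; rs = ag_rows T' i (n + 1)
      in (move_row i (hd rs) (shift_rows (rev rs) T'))((i, i) \<mapsto> y))"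

end

theory Submission
  imports Defs
begin

text \<open>
  Rows of type \<open>\<beta>/\<delta>\<close> are empty off the diagonal, so an insertion with a new label \<open>\<alpha>\<close> or
  \<open>\<gamma>\<close> only pushes the contents of the rows of type \<open>\<alpha>/\<gamma>\<close> above row \<open>i\<close>, and of row \<open>i\<close>
  itself, to the next row of type \<open>\<alpha>/\<gamma>\<close>; the case of a single label is the case \<open>i = 0\<close>.
  The order of the entries in each column is kept, so the result is a tableau. The index \<open>i\<close>
  can be recovered: for \<open>k > i\<close> the cell in column \<open>k\<close> of the first row of type \<open>\<alpha>/\<gamma>\<close>
  above row \<open>k\<close> is empty in the result, whereas for \<open>k = i > 0\<close> it contains the former label
  of \<open>c\<^sub>i\<close>. Once \<open>i\<close> is known, the contents can be pushed back down.
\<close>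

declare not_None_eq [iff del] \<comment> \<open>would hide the shape \<open>z \<noteq> None\<close> used in hypotheses below\<close>

section \<open>Labels and the conditions on a tableau\<close>

definition AG :: "label option set" where "AG = {Some Alpha, Some Gamma}"
definition BD :: "label option set" where "BD = {Some Beta, Some Delta}"

lemma None_notin_AG [simp]: "None \<notin> AG" and None_notin_BD [simp]: "None \<notin> BD"
  by (auto simp: AG_def BD_def)

lemma label_option_cases: "z = None \<or> z \<in> AG \<or> z \<in> BD"
proof (cases z)
  case (Some a)
  then show ?thesis by (cases a) (auto simp: AG_def BD_def)
qed simp

lemma not_NoneI: "z \<in> AG \<Longrightarrow> z \<noteq> None" "z \<in> BD \<Longrightarrow> z \<noteq> None"
  by auto

lemma AG_BD_disjoint: "z \<in> AG \<Longrightarrow> z \<notin> BD"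
  by (auto simp: AG_def BD_def)

lemma staircase_tableauxI:
  assumes "\<And>r k. T (r, k) \<noteq> None \<Longrightarrow> 1 \<le> k \<and> k \<le> r \<and> r \<le> n"
    and "\<And>r. 1 \<le> r \<Longrightarrow> r \<le> n \<Longrightarrow> T (r, r) \<noteq> None"
    and "\<And>r k r'. T (r, k) \<in> AG \<Longrightarrow> r < r' \<Longrightarrow> r' \<le> n \<Longrightarrow> 1 \<le> k \<Longrightarrow> k \<le> r \<Longrightarrow> T (r', k) = None"
    and "\<And>r k k'. T (r, k) \<in> BD \<Longrightarrow> 1 \<le> k' \<Longrightarrow> k' < k \<Longrightarrow> k \<le> r \<Longrightarrow> r \<le> n \<Longrightarrow> T (r, k') = None"
  shows "T \<in> staircase_tableaux n"
proof -
  have "dom T \<subseteq> staircase n"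
  proof
    fix c assume "c \<in> dom T"
    then show "c \<in> staircase n" using assms(1)[of "fst c" "snd c"]
      by (cases c) (simp add: domIff staircase_def)
  qed
  moreover have "\<forall>i\<in>{1..n}. T (i, i) \<noteq> None"
    using assms(2) by auto
  moreover have "\<forall>(i, j)\<in>staircase n. T (i, j) \<in> {Some Alpha, Some Gamma} \<longrightarrow>
        (\<forall>i'. i < i' \<and> i' \<le> n \<longrightarrow> T (i', j) = None)"
    unfolding staircase_def AG_def[symmetric] by (auto intro: assms(3))
  moreover have "\<forall>(i, j)\<in>staircase n. T (i, j) \<in> {Some Beta, Some Delta} \<longrightarrow>
        (\<forall>j'. 1 \<le> j' \<and> j' < j \<longrightarrow> T (i, j') = None)"
    unfolding staircase_def BD_def[symmetric] by (auto intro: assms(4))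
  ultimately show ?thesis unfolding staircase_tableaux_def by blast
qed

context
  fixes T n
  assumes T: "T \<in> staircase_tableaux n"
begin

lemma tableau_dom: "T (r, k) \<noteq> None \<Longrightarrow> 1 \<le> k \<and> k \<le> r \<and> r \<le> n"
  using T by (auto simp: staircase_tableaux_def staircase_def dom_def)

lemma tableau_diag: "1 \<le> r \<Longrightarrow> r \<le> n \<Longrightarrow> T (r, r) \<noteq> None"
  using T by (auto simp: staircase_tableaux_def)

lemma tableau_column:
  assumes "T (r, k) \<in> AG" "r < r'" shows "T (r', k) = None"
proof (cases "r' \<le> n")
  case True
  have "(r, k) \<in> staircase n" using assms(1) tableau_dom[of r k] by (auto simp: staircase_def AG_def)
  then show ?thesis using T assms True unfolding staircase_tableaux_def AG_def by blast
next
  case False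
  then show ?thesis using tableau_dom by blast
qed

lemma tableau_row:
  assumes "T (r, k) \<in> BD" "k' < k" shows "T (r, k') = None"
proof (cases "1 \<le> k'")
  case True
  have "(r, k) \<in> staircase n" using assms(1) tableau_dom[of r k] by (auto simp: staircase_def BD_def)
  then show ?thesis using T assms True unfolding staircase_tableaux_def BD_def by blast
next
  case False
  then show ?thesis using tableau_dom by blast
qed

lemma tableau_diag_cases: "1 \<le> r \<Longrightarrow> r \<le> n \<Longrightarrow> T (r, r) \<in> AG \<or> T (r, r) \<in> BD"
  using tableau_diag label_option_cases by blast

text \<open>The diagonal cell is the rightmost of its row, so \<open>Beta\<close> or
  \<open>Delta\<close> there empties the rest of the row.\<close>

lemma tableau_off_diag_ag:
  assumes "T (r, k) \<noteq> None" "k < r" shows "T (r, r) \<in> AG"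
  using assms tableau_dom[of r k] tableau_diag_cases[of r] tableau_row[of r r k] by fastforce

end

section \<open>The next row of type \<alpha>/\<gamma>\<close>

definition next_ag :: "filling \<Rightarrow> nat \<Rightarrow> nat" where
  "next_ag T k = (LEAST r. k < r \<and> T (r, r) \<in> AG)"

text \<open>Row \<open>m\<close> witnesses that the \<open>LEAST\<close> is attained. After an
  insertion that shifts rows, \<open>m = n + 1\<close> can serve for every
  \<open>k \<le> n\<close>.\<close>

lemma next_ag:
  assumes "T (m, m) \<in> AG" "k < m"
  shows "k < next_ag T k" "T (next_ag T k, next_ag T k) \<in> AG" "next_ag T k \<le> m"
    and "\<And>t. k < t \<Longrightarrow> t < next_ag T k \<Longrightarrow> T (t, t) \<notin> AG"
  unfolding next_ag_def
  using LeastI[of "\<lambda>r. k < r \<and> T (r, r) \<in> AG" m] assms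
  by (auto intro: Least_le dest: not_less_Least)

lemma next_ag_eqI:
  assumes "k < m" "T (m, m) \<in> AG" "\<And>t. k < t \<Longrightarrow> t < m \<Longrightarrow> T (t, t) \<notin> AG"
  shows "next_ag T k = m"
  unfolding next_ag_def using assms by (intro Least_equality) (auto simp: not_less[symmetric])

text \<open>The source of row \<open>m\<close> is the last candidate below it; \<open>i\<close>
  always qualifies, so there is one.\<close>

lemma next_ag_surj:
  assumes "T (m, m) \<in> AG" "i < m"
  obtains r where "i \<le> r" "r < m" "r = i \<or> T (r, r) \<in> AG" "next_ag T r = m"
proof -
  define A where "A = {r. i \<le> r \<and> r < m \<and> (r = i \<or> T (r, r) \<in> AG)}"
  have fin: "finite A" and "i \<in> A" using assms by (auto simp: A_def)
  then have "Max A \<in> A" by (intro Max_in) auto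
  moreover have "next_ag T (Max A) = m"
  proof (rule next_ag_eqI)
    fix t assume "Max A < t" "t < m"
    then have "t \<notin> A" using fin Max_ge by (meson leD)
    then show "T (t, t) \<notin> AG" using \<open>Max A < t\<close> \<open>t < m\<close> \<open>Max A \<in> A\<close> by (auto simp: A_def)
  qed (use assms \<open>Max A \<in> A\<close> in \<open>auto simp: A_def\<close>)
  ultimately show ?thesis using that by (auto simp: A_def)
qed

text \<open>Row \<open>r'\<close> is itself a candidate for \<open>next_ag T r\<close>, so
  \<open>next_ag T r \<le> r' < next_ag T r'\<close>. This is why shifting keeps the order within
  columns.\<close>

lemma next_ag_less:
  assumes "T (m, m) \<in> AG" "r < r'" "r' < m" "T (r', r') \<in> AG"
  shows "next_ag T r < next_ag T r'"
  using next_ag(1)[of T m r'] next_ag(3)[of T r' r] assms by fastforce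

section \<open>The effect of an insertion that shifts rows\<close>

text \<open>How \<open>U\<close> arises from \<open>T\<close> by an insertion at row \<open>i\<close>, up to the labels of \<open>c\<^sub>i\<close> and
  \<open>c\<^sub>n\<^sub>+\<^sub>1\<close> in \<open>U\<close>. The index \<open>i = 0\<close> encodes the insertion of a single \<open>\<alpha>\<close> or \<open>\<gamma>\<close>.\<close>

definition shifted :: "nat \<Rightarrow> nat \<Rightarrow> filling \<Rightarrow> filling \<Rightarrow> bool" where
  "shifted n i T U \<longleftrightarrow> i \<le> n \<and>
     (\<forall>r k. U (r, k) \<noteq> None \<longrightarrow> 1 \<le> k \<and> k \<le> r \<and> r \<le> n + 1) \<and>
     U (n + 1, n + 1) \<in> AG \<and>
     (1 \<le> i \<longrightarrow> U (i, i) \<in> BD) \<and>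
     (\<forall>k<i. U (i, k) = None) \<and>
     (\<forall>r<i. \<forall>k. U (r, k) = T (r, k)) \<and>
     (\<forall>r\<in>{i<..n}. U (r, r) = T (r, r)) \<and>
     (\<forall>r\<in>{i<..n}. U (r, r) \<notin> AG \<longrightarrow> (\<forall>k<r. U (r, k) = None)) \<and>
     (\<forall>r\<in>{i..n}. r = i \<or> U (r, r) \<in> AG \<longrightarrow> (\<forall>k\<in>{1..<next_ag U r}.
        U (next_ag U r, k) = (if k < r \<or> k = i \<and> r = i then T (r, k) else None)))"

context
  fixes n i T U
  assumes S: "shifted n i T U"
begin

lemma shifted_index_le: "i \<le> n"
  and shifted_top: "U (n + 1, n + 1) \<in> AG"
  and shifted_index_bd: "1 \<le> i \<Longrightarrow> U (i, i) \<in> BD"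
  using S by (simp_all add: shifted_def)

lemma shifted_dom: "U (r, k) \<noteq> None \<Longrightarrow> 1 \<le> k \<and> k \<le> r \<and> r \<le> n + 1"
  and shifted_index_row: "k < i \<Longrightarrow> U (i, k) = None"
  and shifted_below: "r < i \<Longrightarrow> U (r, k) = T (r, k)"
  using S by (unfold shifted_def, elim conjE, iprover)+

text \<open>In the last fact, a row in \<open>AG\<close> hands up only its off-diagonal part,
  whereas row \<open>i\<close> also hands up the label of \<open>(i, i)\<close>. For
  \<open>i = 0\<close> nothing is handed up, so the lowest row in \<open>AG\<close> becomes empty
  off the diagonal.\<close>

lemma shifted_diag: "i < r \<Longrightarrow> r \<le> n \<Longrightarrow> U (r, r) = T (r, r)"
  and shifted_bd_row: "i < r \<Longrightarrow> r \<le> n \<Longrightarrow> U (r, r) \<notin> AG \<Longrightarrow> k < r \<Longrightarrow> U (r, k) = None"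
  and shifted_next: "i \<le> r \<Longrightarrow> r \<le> n \<Longrightarrow> r = i \<or> U (r, r) \<in> AG \<Longrightarrow> 1 \<le> k \<Longrightarrow> k < next_ag U r \<Longrightarrow>
    U (next_ag U r, k) = (if k < r \<or> k = i \<and> r = i then T (r, k) else None)"
proof -
  have *: "(\<forall>r\<in>{i<..n}. U (r, r) = T (r, r)) \<and>
    (\<forall>r\<in>{i<..n}. U (r, r) \<notin> AG \<longrightarrow> (\<forall>k<r. U (r, k) = None)) \<and>
    (\<forall>r\<in>{i..n}. r = i \<or> U (r, r) \<in> AG \<longrightarrow> (\<forall>k\<in>{1..<next_ag U r}.
        U (next_ag U r, k) = (if k < r \<or> k = i \<and> r = i then T (r, k) else None)))"
    using S unfolding shifted_def by (elim conjE) (intro conjI)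
  show "i < r \<Longrightarrow> r \<le> n \<Longrightarrow> U (r, r) = T (r, r)"
    using *[THEN conjunct1, rule_format, of r] by simp
  show "i < r \<Longrightarrow> r \<le> n \<Longrightarrow> U (r, r) \<notin> AG \<Longrightarrow> k < r \<Longrightarrow> U (r, k) = None"
    using *[THEN conjunct2, THEN conjunct1, rule_format, of r k] by simp
  show "i \<le> r \<Longrightarrow> r \<le> n \<Longrightarrow> r = i \<or> U (r, r) \<in> AG \<Longrightarrow> 1 \<le> k \<Longrightarrow> k < next_ag U r \<Longrightarrow>
    U (next_ag U r, k) = (if k < r \<or> k = i \<and> r = i then T (r, k) else None)"
    using *[THEN conjunct2, THEN conjunct2, THEN bspec, THEN mp, THEN bspec, of r k] by simp
qed

lemma shifted_next_ag:
  assumes "r \<le> n"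
  shows "r < next_ag U r" "next_ag U r \<le> n + 1" "U (next_ag U r, next_ag U r) \<in> AG"
  using next_ag[of U "n + 1" r, OF shifted_top] assms by auto

text \<open>Traces an entry to its origin in \<open>T\<close>: a nonempty off-diagonal cell forces
  row \<open>s\<close> into \<open>AG\<close>, hence \<open>s\<close> has a source row.\<close>

lemma shifted_off_diag:
  assumes "U (s, j) \<noteq> None" "j < s" "i < s"
  obtains r where "i \<le> r" "r \<le> n" "r < s" "r = i \<or> U (r, r) \<in> AG" "next_ag U r = s"
    "j < r \<or> j = i \<and> r = i" "U (s, j) = T (r, j)" "1 \<le> j"
proof -
  have sj: "1 \<le> j" "s \<le> n + 1" using shifted_dom[OF assms(1)] by auto
  have "U (s, s) \<in> AG" using shifted_bd_row[of s j] shifted_top assms sj by (cases "s = n + 1") auto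
  then obtain r where r: "i \<le> r" "r < s" "r = i \<or> U (r, r) \<in> AG" "next_ag U r = s"
    using next_ag_surj assms(3) by blast
  then have "U (s, j) = (if j < r \<or> j = i \<and> r = i then T (r, j) else None)"
    using shifted_next[of r j] assms sj by auto
  then show ?thesis using that[of r] r assms sj by (auto split: if_splits)
qed

text \<open>Moved entries of a column keep their vertical order, and those of a row share their
  origin row, so a conflict between them in \<open>U\<close> would already be one in
  \<open>T\<close>.\<close>

lemma shifted_tableau:
  assumes T: "T \<in> staircase_tableaux n"
  shows "U \<in> staircase_tableaux (n + 1)"
proof (rule staircase_tableauxI)
  show "1 \<le> k \<and> k \<le> r \<and> r \<le> n + 1" if "U (r, k) \<noteq> None" for r k
    using shifted_dom[OF that] .
next
  fix r assume r: "1 \<le> r" "r \<le> n + 1"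
  consider "r < i" | "r = i" | "i < r" "r \<le> n" | "r = n + 1" using r by linarith
  then show "U (r, r) \<noteq> None"
  proof cases
    case 1 then show ?thesis using shifted_below tableau_diag[OF T] r shifted_index_le by simp
  next
    case 2 then show ?thesis using shifted_index_bd r by (metis None_notin_BD)
  next
    case 3 then show ?thesis using shifted_diag tableau_diag[OF T] r by simp
  next
    case 4 then show ?thesis using shifted_top by (metis None_notin_AG)
  qed
next
  fix s j s' assume ag: "U (s, j) \<in> AG" and s': "s < s'" "s' \<le> n + 1" and j: "1 \<le> j" "j \<le> s"
  have ne: "U (s, j) \<noteq> None" using ag by (rule not_NoneI)
  show "U (s', j) = None"
  proof (rule ccontr)
    assume ne': "U (s', j) \<noteq> None"
    consider "s' < i" | "s' = i" | "i < s'" by linarith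
    then show False
    proof cases
      case 1
      then show False using ne' ag s' tableau_column[OF T, of s j s'] shifted_below by simp
    next
      case 2
      then show False using shifted_index_row[of j] ne' j s' by simp
    next
      case 3
      obtain r' where r': "i \<le> r'" "r' \<le> n" "r' < s'" "r' = i \<or> U (r', r') \<in> AG" "next_ag U r' = s'"
        "j < r' \<or> j = i \<and> r' = i" "U (s', j) = T (r', j)"
        using shifted_off_diag[OF ne' _ 3] j s' by (metis le_less_trans)
      consider "s < i" | "s = i" | "i < s" "s = j" | "i < s" "j < s" using j by linarith
      then show False
      proof cases
        case 1
        then show False using ag shifted_below tableau_column[OF T, of s j r'] r' ne' by simp
      next
        case 2
        then show False using ag shifted_index_row[of j] shifted_index_bd AG_BD_disjoint j
          by (cases "j = i") auto
      next
        case 3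
        \<comment> \<open>The alternative \<open>j = i\<close> is excluded by
          \<open>i < s = j\<close>.\<close>
        then have "j < r'" using r' by auto
        moreover have "T (j, j) \<in> AG" using ag shifted_diag[of s] 3 r' by auto
        ultimately show False using tableau_column[OF T] r' ne' by metis
      next
        case 4
        then obtain r where r: "i \<le> r" "r \<le> n" "r < s" "r = i \<or> U (r, r) \<in> AG" "next_ag U r = s"
          "U (s, j) = T (r, j)"
          using shifted_off_diag[OF ne] by metis
        \<comment> \<open>Otherwise monotonicity of \<open>next_ag\<close> would give
          \<open>s' \<le> s\<close>.\<close>
        have "r < r'"
        proof (rule ccontr)
          assume "\<not> r < r'"
          then have "r' < r" using r r' s' by (cases "r = r'") auto
          then have "next_ag U r' < next_ag U r"
            using next_ag_less[of U "n + 1" r' r, OF shifted_top] r r' by auto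
          then show False using r r' s' by simp
        qed
        then show False using tableau_column[OF T, of r j r'] r r' ag ne' by simp
      qed
    qed
  qed
next
  fix s j j' assume bd: "U (s, j) \<in> BD" and j: "1 \<le> j'" "j' < j" "j \<le> s" and s: "s \<le> n + 1"
  have ne: "U (s, j) \<noteq> None" using bd by (rule not_NoneI)
  consider "s < i" | "s = i" | "i < s" "j = s" | "i < s" "j < s" using j by linarith
  then show "U (s, j') = None"
  proof cases
    case 1 then show ?thesis using shifted_below tableau_row[OF T] bd j by metis
  next
    case 2 then show ?thesis using shifted_index_row j by simp
  next
    case 3
    then have "U (s, s) \<notin> AG" using bd AG_BD_disjoint by auto
    then show ?thesis using shifted_bd_row[of s j'] 3 j s shifted_top by (cases "s = n + 1") auto
  next
    case 4
    obtain r where r: "i \<le> r" "r \<le> n" "r = i \<or> U (r, r) \<in> AG" "next_ag U r = s"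
      "j < r \<or> j = i \<and> r = i" "U (s, j) = T (r, j)"
      using shifted_off_diag[OF ne 4(2,1)] by metis
    then have "T (r, j') = None" using tableau_row[OF T] bd j by metis
    then show ?thesis using shifted_next[of r j'] r j 4 by auto
  qed
qed

text \<open>Together these make \<open>i\<close> the largest \<open>k \<le> n\<close> whose cell
  \<open>(next_ag U k, k)\<close> is labelled, or 0 if there is none, so \<open>U\<close> alone
  determines \<open>i\<close>.\<close>

lemma shifted_index:
  assumes T: "T \<in> staircase_tableaux n"
  shows "i \<noteq> 0 \<Longrightarrow> U (next_ag U i, i) \<noteq> None"
    and "i < k \<Longrightarrow> k \<le> n \<Longrightarrow> U (next_ag U k, k) = None"
proof -
  show "U (next_ag U i, i) \<noteq> None" if "i \<noteq> 0"
    using that shifted_next[of i i] shifted_next_ag[of i] shifted_index_le tableau_diag[OF T] by simp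
  show "U (next_ag U k, k) = None" if k: "i < k" "k \<le> n"
  proof (rule ccontr)
    assume ne: "U (next_ag U k, k) \<noteq> None"
    note N = shifted_next_ag[OF k(2)]
    obtain r where r: "r \<le> n" "r = i \<or> U (r, r) \<in> AG" "next_ag U r = next_ag U k"
      "k < r \<or> k = i \<and> r = i" "r < next_ag U k"
      using shifted_off_diag[OF ne N(1)] k N by (metis order.strict_trans)
    \<comment> \<open>The origin \<open>r\<close> would be a row in \<open>AG\<close> strictly
      between \<open>k\<close> and \<open>next_ag U k\<close>.\<close>
    then have "k < r" "U (r, r) \<in> AG" using k by auto
    then show False using next_ag(3)[of U r k] r by simp
  qed
qed

end

section \<open>Uniqueness of index, source and result\<close>

lemma shifted_index_unique:
  assumes "shifted n i T U" "shifted n i' T' U" "T \<in> staircase_tableaux n" "T' \<in> staircase_tableaux n"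
  shows "i = i'"
proof -
  \<comment> \<open>The larger of two indices would make the same cell both labelled and
    empty.\<close>
  have "\<not> i < i'" using shifted_index(1)[OF assms(2,4)] shifted_index(2)[OF assms(1,3)]
      shifted_index_le[OF assms(2)] by (metis not_less_zero)
  moreover have "\<not> i' < i" using shifted_index(1)[OF assms(1,3)] shifted_index(2)[OF assms(2,4)]
      shifted_index_le[OF assms(1)] by (metis not_less_zero)
  ultimately show ?thesis by simp
qed

lemma shifted_source_unique:
  assumes S: "shifted n i T U" "shifted n i T' U"
    and T: "T \<in> staircase_tableaux n" "T' \<in> staircase_tableaux n"
  shows "T = T'"
proof -
  \<comment> \<open>The right-hand side depends only on \<open>U\<close>, \<open>i\<close> and
    \<open>n\<close>: it pushes the contents back down. Row \<open>i\<close> regains its diagonal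
    label too; the other rows kept theirs.\<close>
  have val: "V (r, k) = (if 1 \<le> k \<and> k \<le> r \<and> r \<le> n then
      if r < i \<or> k = r \<and> r \<noteq> i then U (r, k)
      else if r = i \<or> U (r, r) \<in> AG then U (next_ag U r, k) else None else None)"
    if S: "shifted n i V U" and V: "V \<in> staircase_tableaux n" for V r k
  proof (cases "1 \<le> k \<and> k \<le> r \<and> r \<le> n")
    case False
    then show ?thesis using tableau_dom[OF V] by metis
  next
    case rk: True
    consider "r < i" | "i < r" "k = r" | "r = i" | "i < r" "k < r" "U (r, r) \<in> AG"
      | "i < r" "k < r" "U (r, r) \<notin> AG" using rk by linarith
    then show ?thesis
    proof cases
      case 1 then show ?thesis using shifted_below[OF S] rk by simp
    next
      case 2 then show ?thesis using shifted_diag[OF S] rk by simp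
    next
      case 3 then show ?thesis
        using shifted_next[OF S, of r k] rk shifted_next_ag[OF S, of r] by auto
    next
      case 4 then show ?thesis
        using shifted_next[OF S, of r k] rk shifted_next_ag[OF S, of r] by simp
    next
      case 5
      then have "V (r, r) \<notin> AG" using shifted_diag[OF S, of r] rk by simp
      then have "V (r, k) = None" using tableau_off_diag_ag[OF V] 5 by blast
      then show ?thesis using 5 by simp
    qed
  qed
  show ?thesis using val[OF S(1) T(1)] val[OF S(2) T(2)] by (intro ext) (metis surj_pair)
qed

text \<open>Needed for surjectivity: inserting the data extracted from a tableau gives that tableau
  back.\<close>

lemma shifted_target_unique:
  assumes S: "shifted n i T U" "shifted n i T U'"
    and top: "U (n + 1, n + 1) = U' (n + 1, n + 1)" and ii: "i \<noteq> 0 \<Longrightarrow> U (i, i) = U' (i, i)"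
  shows "U = U'"
proof -
  \<comment> \<open>Diagonals come first: \<open>next_ag\<close> reads nothing else, so the source
    rows then agree as well.\<close>
  have diag: "U (r, r) = U' (r, r)" for r
  proof -
    consider "r < i" | "r = i" "i \<noteq> 0" | "r = 0" | "i < r" "r \<le> n" | "r = n + 1" | "n + 1 < r"
      by linarith
    then show ?thesis
    proof cases
      case 1 then show ?thesis using shifted_below[OF S(1)] shifted_below[OF S(2)] by simp
    next
      case 3 then show ?thesis using shifted_dom[OF S(1), of 0 0] shifted_dom[OF S(2), of 0 0] by force
    next
      case 4 then show ?thesis using shifted_diag[OF S(1)] shifted_diag[OF S(2)] by simp
    next
      case 6 then show ?thesis using shifted_dom[OF S(1), of r r] shifted_dom[OF S(2), of r r] by force
    qed (use top ii in auto)
  qed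
  have nxt: "next_ag U = next_ag U'" by (intro ext) (simp add: next_ag_def diag)
  have "U (r, k) = U' (r, k)" for r k
  proof -
    consider "\<not> (1 \<le> k \<and> k \<le> r \<and> r \<le> n + 1)" | "r < i" | "k = r" | "r = i" "k < r"
      | "i < r" "1 \<le> k" "k < r" "r \<le> n + 1" "U (r, r) \<notin> AG"
      | "i < r" "1 \<le> k" "k < r" "r \<le> n + 1" "U (r, r) \<in> AG"
      by linarith
    then show ?thesis
    proof cases
      case 1 then show ?thesis using shifted_dom[OF S(1), of r k] shifted_dom[OF S(2), of r k] by metis
    next
      case 2 then show ?thesis using shifted_below[OF S(1)] shifted_below[OF S(2)] by simp
    next
      case 3 then show ?thesis using diag by simp
    next
      case 4 then show ?thesis using shifted_index_row[OF S(1)] shifted_index_row[OF S(2)] by simp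
    next
      case 5
      then have "r \<le> n" using shifted_top[OF S(1)] by (cases "r = n + 1") auto
      then show ?thesis
        using shifted_bd_row[OF S(1), of r k] shifted_bd_row[OF S(2), of r k] 5 diag by simp
    next
      case 6
      obtain s where "i \<le> s" "s < r" "s = i \<or> U (s, s) \<in> AG" "next_ag U s = r"
        using next_ag_surj[of U r i, OF 6(5,1)] .
      then show ?thesis
        using shifted_next[OF S(1), of s k] shifted_next[OF S(2), of s k] 6 nxt diag by simp
    qed
  qed
  then show ?thesis by (intro ext) (metis surj_pair)
qed

section \<open>Pushing the contents back down\<close>

lemma unshift:
  assumes U: "U \<in> staircase_tableaux (n + 1)" and top: "U (n + 1, n + 1) \<in> AG"
  obtains i T where "T \<in> staircase_tableaux n" "shifted n i T U"
proof -
  note N = next_ag[of U "n + 1", OF top]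
  obtain i where i: "i \<le> n" "i = 0 \<or> U (next_ag U i, i) \<noteq> None"
    and above: "\<And>k. i < k \<Longrightarrow> k \<le> n \<Longrightarrow> U (next_ag U k, k) = None"
  proof -
    \<comment> \<open>This choice of \<open>i\<close> is forced by \<open>shifted_index\<close>; 0
      keeps \<open>A\<close> nonempty and encodes a single label.\<close>
    define A where "A = {k. k \<le> n \<and> (k = 0 \<or> U (next_ag U k, k) \<noteq> None)}"
    have fin: "finite A" and "0 \<in> A" by (auto simp: A_def)
    then have "Max A \<in> A" by (intro Max_in) auto
    then have "Max A \<le> n" "Max A = 0 \<or> U (next_ag U (Max A), Max A) \<noteq> None"
      unfolding A_def by blast+
    moreover have "U (next_ag U k, k) = None" if "Max A < k" "k \<le> n" for k
    proof -
      have "k \<notin> A" using that fin Max_ge by (meson leD)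
      then show ?thesis using that by (auto simp: A_def)
    qed
    ultimately show ?thesis by (rule that)
  qed
  \<comment> \<open>Row \<open>i\<close> takes back columns up to \<open>i\<close>, its diagonal
    cell included; higher rows in \<open>AG\<close> keep their diagonal label. Row
    \<open>n + 1\<close> is dropped.\<close>
  define T where "T = (\<lambda>(r, k). if 1 \<le> k \<and> k \<le> r \<and> r \<le> n then
     if r = i \<or> i < r \<and> U (r, r) \<in> AG \<and> k < r then U (next_ag U r, k) else U (r, k) else None)"
  have bd: "U (r, k) = None" if "U (r, r) \<notin> AG" "k < r" for r k
    using tableau_off_diag_ag[OF U] that by blast
  \<comment> \<open>Row \<open>next_ag U i\<close> has a label above \<open>(i, i)\<close> in column
    \<open>i\<close>, which rules out \<open>AG\<close>.\<close>
  have i_bd: "U (i, i) \<in> BD" if "1 \<le> i"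
    using that i tableau_column[OF U, of i i "next_ag U i"] N(1)[of i]
      tableau_diag_cases[OF U, of i] by force
  have T_below: "T (r, k) = U (r, k)" if "r < i" for r k
  proof (cases "1 \<le> k \<and> k \<le> r")
    case True
    then show ?thesis using that i by (simp add: T_def)
  next
    case False
    then show ?thesis using that tableau_dom[OF U, of r k] by (force simp: T_def)
  qed
  have T_tab: "T \<in> staircase_tableaux n"
  proof (rule staircase_tableauxI)
    show "1 \<le> k \<and> k \<le> r \<and> r \<le> n" if "T (r, k) \<noteq> None" for r k
      using that by (auto simp: T_def split: if_splits)
    show "T (r, r) \<noteq> None" if "1 \<le> r" "r \<le> n" for r
      using that tableau_diag[OF U, of r] i(2) by (auto simp: T_def)
  next
    fix r k r' assume ag: "T (r, k) \<in> AG" and r: "r < r'" "r' \<le> n" "1 \<le> k" "k \<le> r"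
    note N' = N(1)[of r'] N(1)[of r]
    show "T (r', k) = None"
    \<comment> \<open>In the first case \<open>U\<close> is empty above \<open>(r, k)\<close>, and
      \<open>T (r', k)\<close> is read from row \<open>r'\<close> or higher. Otherwise the entry
      came down from row \<open>next_ag U r\<close>.\<close>
    proof (cases "U (r, k) \<in> AG \<and> (r < i \<or> i < r)")
      case True
      then show ?thesis
        using r N' tableau_column[OF U, of r k r'] tableau_column[OF U, of r k "next_ag U r'"]
        by (auto simp: T_def)
    next
      case False
      then have ri: "i \<le> r" "r = i \<or> U (r, r) \<in> AG" "U (next_ag U r, k) \<in> AG"
        using ag by (auto simp: T_def split: if_splits)
      show ?thesis
      proof (cases "U (r', r') \<in> AG")
        case True
        then show ?thesis using next_ag_less[of U "n + 1" r r', OF top] ri r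
            tableau_column[OF U, of "next_ag U r" k "next_ag U r'"]
          by (auto simp: T_def)
      next
        case False
        then show ?thesis using bd[of r' k] r ri by (auto simp: T_def)
      qed
    qed
  next
    fix r k k' assume b: "T (r, k) \<in> BD" and r: "1 \<le> k'" "k' < k" "k \<le> r" "r \<le> n"
    show "T (r, k') = None"
    proof (cases "r = i \<or> i < r \<and> U (r, r) \<in> AG")
      case True
      \<comment> \<open>For \<open>r \<noteq> i\<close> the diagonal label is unchanged and in
        \<open>AG\<close>, so an entry in \<open>BD\<close> lies to its left.\<close>
      moreover have "r = i \<or> k < r" using b r True AG_BD_disjoint by (cases "k = r") (auto simp: T_def)
      ultimately show ?thesis using b r tableau_row[OF U, of "next_ag U r" k k'] by (auto simp: T_def)
    next
      case False
      then show ?thesis using b r tableau_row[OF U, of r k k'] by (auto simp: T_def)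
    qed
  qed
  have "shifted n i T U"
    unfolding shifted_def
  proof (intro conjI allI impI ballI)
    show "1 \<le> k" "k \<le> r" "r \<le> n + 1" if "U (r, k) \<noteq> None" for r k
      using tableau_dom[OF U that] by auto
    show "U (i, k) = None" if "k < i" for k
      using tableau_row[OF U, of i i k] i_bd that by simp
    show "U (r, r) = T (r, r)" if "r \<in> {i<..n}" for r
      using that by (auto simp: T_def)
  next
    fix r k assume r: "r \<in> {i..n}" "r = i \<or> U (r, r) \<in> AG" and k: "k \<in> {1..<next_ag U r}"
    note Nr = N[of r]
    show "U (next_ag U r, k) = (if k < r \<or> k = i \<and> r = i then T (r, k) else None)"
    proof (cases "k < r \<or> k = i \<and> r = i")
      case True
      then show ?thesis using r k by (auto simp: T_def)
    next
      case False
      then have rk: "r \<le> k" "i < k" using r by auto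
      \<comment> \<open>No row in \<open>AG\<close> lies between \<open>r\<close> and
        \<open>next_ag U r\<close>, so maximality of \<open>i\<close>, applied to \<open>k\<close>,
        shows the cell empty.\<close>
      have "next_ag U k = next_ag U r"
        using Nr rk k r by (intro next_ag_eqI) auto
      moreover have "k \<le> n" using Nr k r by auto
      ultimately show ?thesis using above[of k] rk False by simp
    qed
  qed (use i top i_bd bd T_below in auto)
  with T_tab show ?thesis using that by blast
qed

section \<open>The successive row moves\<close>

lemma shift_rows:
  assumes "sorted_wrt (>) xs" "xs \<noteq> []" "\<And>k. k < hd xs \<Longrightarrow> T (hd xs, k) = None"
    and "\<And>r. T (r, 0) = None"
  shows "r \<notin> set xs \<Longrightarrow> shift_rows xs T (r, k) = T (r, k)"
    and "r \<le> k \<Longrightarrow> shift_rows xs T (r, k) = T (r, k)"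
    and "a \<in> set xs \<Longrightarrow> b \<in> set xs \<Longrightarrow> a < b \<Longrightarrow> (\<And>c. c \<in> set xs \<Longrightarrow> \<not> (a < c \<and> c < b)) \<Longrightarrow>
      k < b \<Longrightarrow> shift_rows xs T (b, k) = (if k < a then T (a, k) else None)"
    and "k < last xs \<Longrightarrow> shift_rows xs T (last xs, k) = None"
    and "shift_rows xs T (r, 0) = None"
proof -
  \<comment> \<open>The third hypothesis makes the first move defined. Each move empties its source
    row left of the diagonal, and that row is the next target, so the precondition persists.\<close>
  have "(r \<notin> set xs \<longrightarrow> shift_rows xs T (r, k) = T (r, k)) \<and>
    (r \<le> k \<longrightarrow> shift_rows xs T (r, k) = T (r, k)) \<and>
    (a \<in> set xs \<and> b \<in> set xs \<and> a < b \<and> (\<forall>c \<in> set xs. \<not> (a < c \<and> c < b)) \<and> k < b \<longrightarrow>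
      shift_rows xs T (b, k) = (if k < a then T (a, k) else None)) \<and>
    (k < last xs \<longrightarrow> shift_rows xs T (last xs, k) = None) \<and>
    shift_rows xs T (r, 0) = None" for r k a b
    using assms
  proof (induction xs T arbitrary: r k a b rule: shift_rows.induct)
    case (1 i2 i1 rs T)
    let ?xs = "i1 # rs" and ?T = "move_row_star i1 i2 T"
    have lt: "i1 < i2" and rs: "\<And>c. c \<in> set rs \<Longrightarrow> c < i1" using 1(2) by auto
    have e: "\<And>k. k < i2 \<Longrightarrow> T (i2, k) = None" using "1.prems"(3) by simp
    then have "empty_off_diagonal T i2" by (simp add: empty_off_diagonal_def)
    \<comment> \<open>As column 0 is empty, \<open>k \<in> {1..<i1}\<close> may be relaxed to
      \<open>k < i1\<close>.\<close>
    then have T1: "?T (r, k) = (if k < i1 \<and> r = i2 then T (i1, k)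
        else if k < i1 \<and> r = i1 then None else T (r, k))" for r k
      using lt "1.prems"(4) by (cases "k = 0") (auto simp: move_row_star_def move_cells_def)
    have IH: "(r \<notin> set ?xs \<longrightarrow> shift_rows ?xs ?T (r, k) = ?T (r, k)) \<and>
      (r \<le> k \<longrightarrow> shift_rows ?xs ?T (r, k) = ?T (r, k)) \<and>
      (a \<in> set ?xs \<and> b \<in> set ?xs \<and> a < b \<and> (\<forall>c \<in> set ?xs. \<not> (a < c \<and> c < b)) \<and> k < b \<longrightarrow>
        shift_rows ?xs ?T (b, k) = (if k < a then ?T (a, k) else None)) \<and>
      (k < last ?xs \<longrightarrow> shift_rows ?xs ?T (last ?xs, k) = None) \<and>
      shift_rows ?xs ?T (r, 0) = None" for r k a b
      by (rule "1.IH") (use "1.prems" lt T1 in auto)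
    show ?case
    proof (intro conjI impI)
      assume "r \<notin> set (i2 # i1 # rs)"
      then show "shift_rows (i2 # i1 # rs) T (r, k) = T (r, k)"
        using IH[of r k] T1[of r k] by auto
    next
      assume "r \<le> k"
      then show "shift_rows (i2 # i1 # rs) T (r, k) = T (r, k)"
        using IH[of r k] T1[of r k] lt by auto
    next
      assume ab: "a \<in> set (i2 # i1 # rs) \<and> b \<in> set (i2 # i1 # rs) \<and> a < b \<and>
        (\<forall>c \<in> set (i2 # i1 # rs). \<not> (a < c \<and> c < b)) \<and> k < b"
      show "shift_rows (i2 # i1 # rs) T (b, k) = (if k < a then T (a, k) else None)"
      proof (cases "b = i2")
        case True
        have "a = i1" using ab True lt rs by (metis less_irrefl not_less_iff_gr_or_eq set_ConsD list.set_intros)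
        moreover have "b \<notin> set ?xs" using True lt rs by fastforce
        ultimately show ?thesis using IH[of b k] T1[of b k] e ab True by auto
      next
        case False
        \<comment> \<open>The first move touches only rows \<open>i1\<close> and \<open>i2\<close>,
          so row \<open>a\<close> is still as in \<open>T\<close>.\<close>
        then have "b \<in> set ?xs" "a \<in> set rs" using ab lt rs by force+
        then show ?thesis using IH[of b k a b] ab T1[of a k] rs[of a] lt by auto
      qed
    next
      assume "k < last (i2 # i1 # rs)"
      then show "shift_rows (i2 # i1 # rs) T (last (i2 # i1 # rs), k) = None" using IH by simp
    next
      show "shift_rows (i2 # i1 # rs) T (r, 0) = None" using IH by simp
    qed
  qed auto
  then show "r \<notin> set xs \<Longrightarrow> shift_rows xs T (r, k) = T (r, k)"
    "r \<le> k \<Longrightarrow> shift_rows xs T (r, k) = T (r, k)"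
    "a \<in> set xs \<Longrightarrow> b \<in> set xs \<Longrightarrow> a < b \<Longrightarrow> (\<And>c. c \<in> set xs \<Longrightarrow> \<not> (a < c \<and> c < b)) \<Longrightarrow>
      k < b \<Longrightarrow> shift_rows xs T (b, k) = (if k < a then T (a, k) else None)"
    "k < last xs \<Longrightarrow> shift_rows xs T (last xs, k) = None"
    "shift_rows xs T (r, 0) = None"
    by blast+
qed

section \<open>Insertion realises the shift\<close>

definition insertion_elt :: "label \<Rightarrow> label \<Rightarrow> nat \<Rightarrow> elt" where
  "insertion_elt x y i = (if i = 0 then Single x else Triple x y i)"

lemma insertion_elts_cases:
  assumes "e \<in> insertion_elts n"
  obtains y where "e = Single y" "Some y \<in> BD"
  | x y i where "e = insertion_elt x y i" "Some x \<in> AG" "Some y \<in> BD" "i \<le> n"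
proof -
  have "Some Beta \<in> BD" by (simp add: BD_def)
  \<comment> \<open>\<open>Beta\<close> is a filler, since a single label has no second
    component.\<close>
  moreover have "Some x \<in> AG \<Longrightarrow> Single x = insertion_elt x Beta 0" for x
    by (simp add: insertion_elt_def)
  moreover have "1 \<le> i \<Longrightarrow> Triple x y i = insertion_elt x y i" for x y i
    by (simp add: insertion_elt_def)
  ultimately show ?thesis
    using assms that by (auto simp: insertion_elts_def AG_def BD_def)
qed

lemma insertion_elt_mem:
  "Some x \<in> AG \<Longrightarrow> Some y \<in> BD \<Longrightarrow> i \<le> n \<Longrightarrow> insertion_elt x y i \<in> insertion_elts n"
  by (auto simp: insertion_elts_def insertion_elt_def AG_def BD_def)

text \<open>Links the operations to \<open>shifted\<close>; in particular all moves meet their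
  preconditions, so \<open>undefined\<close> never arises. The last two conclusions give the labels
  that \<open>shifted\<close> leaves open.\<close>

lemma insertion_shifted:
  assumes T: "T \<in> staircase_tableaux n" and x: "Some x \<in> AG" and y: "Some y \<in> BD" and i: "i \<le> n"
  defines "U \<equiv> insertion n T (insertion_elt x y i)"
  shows "shifted n i T U" "U (n + 1, n + 1) = Some x" "i \<noteq> 0 \<Longrightarrow> U (i, i) = Some y"
proof -
  define T' where "T' = add_row n T x"
  define rs where "rs = ag_rows T' i (n + 1)"
  define V where "V = shift_rows (rev rs) T'"
  have T': "T' (r, k) = (if r = n + 1 \<and> k = n + 1 then Some x else T (r, k))" for r k
    by (simp add: T'_def add_row_def)
  have set_rs: "set rs = {r. i < r \<and> r \<le> n + 1 \<and> T' (r, r) \<in> AG}"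
    by (auto simp: rs_def ag_rows_def AG_def)
  have sorted: "sorted_wrt (<) rs"
    unfolding rs_def ag_rows_def by (intro sorted_wrt_filter) (rule sorted_wrt_upt)
  \<comment> \<open>The new row is in \<open>AG\<close> and empty off the diagonal, so
    \<open>rs\<close> is nonempty and the first move has a free target.\<close>
  have rs_eq: "rs = filter (\<lambda>r. T' (r, r) \<in> AG) [i + 1..<n + 1] @ [n + 1]"
    using i x T' by (simp add: rs_def ag_rows_def AG_def)
  then have rs_ne: "rs \<noteq> []" and last_rs: "last rs = n + 1" by auto
  have out: "T (r, k) = None" if "\<not> (1 \<le> k \<and> k \<le> r \<and> r \<le> n)" for r k
    using tableau_dom[OF T] that by blast
  have V1: "r \<notin> set rs \<Longrightarrow> V (r, k) = T' (r, k)"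
    and V2: "r \<le> k \<Longrightarrow> V (r, k) = T' (r, k)"
    and V3: "a \<in> set rs \<Longrightarrow> b \<in> set rs \<Longrightarrow> a < b \<Longrightarrow> (\<And>c. c \<in> set rs \<Longrightarrow> \<not> (a < c \<and> c < b)) \<Longrightarrow>
      k < b \<Longrightarrow> V (b, k) = (if k < a then T' (a, k) else None)"
    and V4: "k < hd rs \<Longrightarrow> V (hd rs, k) = None"
    and V5: "V (r, 0) = None" for r k a b
    using shift_rows[of "rev rs" T'] sorted rs_ne T' out last_rs
    by (auto simp: V_def sorted_wrt_rev hd_rev last_rev)
  have hd_in: "hd rs \<in> set rs" using rs_ne by simp
  then have hd_gt: "i < hd rs" "hd rs \<le> n + 1" by (auto simp: set_rs)
  have hd_le: "hd rs \<le> r" if "r \<in> set rs" for r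
    using sorted that by (cases rs) auto
  \<comment> \<open>This covers both kinds of insertion: for \<open>i = 0\<close> the range
    \<open>1 \<le> k \<and> k \<le> i\<close> is empty.\<close>
  have U_eq: "U (r, k) = (if r = i \<and> k = i \<and> i \<noteq> 0 then Some y
     else if 1 \<le> k \<and> k \<le> i \<and> r = hd rs then V (i, k)
     else if 1 \<le> k \<and> k \<le> i \<and> r = i then None else V (r, k))" for r k
  proof (cases "i = 0")
    case True
    have "U = V" using True x
      by (auto simp: U_def V_def rs_def T'_def insertion_elt_def Let_def AG_def)
    then show ?thesis using True by auto
  next
    case False
    \<comment> \<open>The chain of moves leaves its lowest row free for the content of row
      \<open>i\<close>.\<close>
    have "empty_off_diagonal V (hd rs)" using V4 by (auto simp: empty_off_diagonal_def)
    then have "U = (move_cells {1..i} i (hd rs) V)((i, i) \<mapsto> y)"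
      using False hd_gt
      by (simp add: U_def V_def rs_def T'_def insertion_elt_def Let_def move_row_def)
    then show ?thesis using False by (auto simp: move_cells_def)
  qed
  \<comment> \<open>The last move fills only columns up to \<open>i < hd rs\<close>, off the
    diagonal.\<close>
  have diag: "U (r, r) = T' (r, r)" if "r \<noteq> i" for r
    using that U_eq[of r r] V2[of r r] hd_gt by auto
  have top: "U (n + 1, n + 1) = Some x" using diag[of "n + 1"] i T' by simp
  have ag_iff: "r \<in> set rs \<longleftrightarrow> U (r, r) \<in> AG" if "i < r" for r
    using that diag[of r] out[of r r] T'[of r r] by (cases "r \<le> n") (auto simp: set_rs)
  have i_notin: "i \<notin> set rs" by (simp add: set_rs)
  show "U (n + 1, n + 1) = Some x" "i \<noteq> 0 \<Longrightarrow> U (i, i) = Some y"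
    using top U_eq by auto
  have V_i: "V (i, k) = T (i, k)" for k using V1[OF i_notin] T' i by simp
  note N = next_ag[of U "n + 1", unfolded top, OF x]
  have N_i: "next_ag U i = hd rs"
  proof (rule next_ag_eqI)
    show "U (t, t) \<notin> AG" if "i < t" "t < hd rs" for t
      using that ag_iff[of t] hd_le[of t] by auto
  qed (use hd_gt hd_in ag_iff in auto)
  have below: "U (r, k) = T (r, k)" if "r < i" for r k
    using that U_eq[of r k] hd_gt V1[of r k] T' i by (auto simp: set_rs)
  have next_i: "U (hd rs, k) = (if k \<le> i then T (i, k) else None)" if "1 \<le> k" "k < hd rs" for k
    using that U_eq[of "hd rs" k] hd_gt V_i[of k] V4[of k] by auto
  have next_ag: "U (next_ag U r, k) = (if k < r then T (r, k) else None)"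
    if r: "i < r" "r \<le> n" "U (r, r) \<in> AG" "k < next_ag U r" for r k
  proof -
    have Nr: "r < next_ag U r" "U (next_ag U r, next_ag U r) \<in> AG"
      "\<And>t. r < t \<Longrightarrow> t < next_ag U r \<Longrightarrow> U (t, t) \<notin> AG" using N[of r] r by auto
    have "hd rs \<le> r" using hd_le ag_iff r by simp
    \<comment> \<open>Row \<open>next_ag U r\<close> is strictly above \<open>hd rs\<close>, out of
      reach of the last move.\<close>
    then have "U (next_ag U r, k) = V (next_ag U r, k)" using U_eq Nr r by auto
    also have "\<dots> = (if k < r then T' (r, k) else None)"
    proof (rule V3)
      show "\<not> (r < c \<and> c < next_ag U r)" if "c \<in> set rs" for c
        using Nr(3)[of c] ag_iff[of c] that r by auto
    qed (use ag_iff r Nr in auto)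
    finally show ?thesis using T' r by simp
  qed
  have bd: "U (r, k) = None" if "i < r" "U (r, r) \<notin> AG" "k < r" for r k
  proof -
    have "r \<notin> set rs" using that ag_iff by simp
    then have "U (r, k) = T (r, k)"
      using V1[of r k] U_eq[of r k] hd_in that T' by auto
    then show ?thesis using tableau_off_diag_ag[OF T, of r k] that diag[of r] T'[of r r] x
      by (cases "T (r, k)") (auto split: if_splits)
  qed
  have dom: "1 \<le> k \<and> k \<le> r \<and> r \<le> n + 1" if ne: "U (r, k) \<noteq> None" for r k
  proof -
    have "1 \<le> k"
      using ne U_eq[of r k] V5[of r] by (cases "k = 0") (auto split: if_splits)
    moreover have "k \<le> r"
      using ne U_eq[of r k] V2[of r k] T'[of r k] out[of k r] hd_gt
      by (fastforce split: if_splits)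
    moreover have "r \<le> n + 1"
    proof (rule ccontr)
      assume r: "\<not> r \<le> n + 1"
      then show False using ne U_eq[of r k] V1[of r k] T'[of r k] out[of k r] hd_gt i
        by (auto simp: set_rs split: if_splits)
    qed
    ultimately show ?thesis by simp
  qed
  show "shifted n i T U"
    unfolding shifted_def
  proof (intro conjI allI impI ballI)
    show "U (i, i) \<in> BD" if "1 \<le> i" using that U_eq y by simp
    show "U (i, k) = None" if "k < i" for k
      using that U_eq[of i k] V5[of i] hd_gt by (cases "k = 0") auto
    show "U (r, r) = T (r, r)" if "r \<in> {i<..n}" for r
      using that diag[of r] T' by simp
  next
    fix r k assume "r \<in> {i..n}" "r = i \<or> U (r, r) \<in> AG" "k \<in> {1..<next_ag U r}"
    then show "U (next_ag U r, k) = (if k < r \<or> k = i \<and> r = i then T (r, k) else None)"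
      using next_i[of k] next_ag[of r k] N_i by (cases "r = i") auto
  next
    fix r k assume "U (r, k) \<noteq> None"
    then show "1 \<le> k" "k \<le> r" "r \<le> n + 1" using dom by blast+
  next
    show "U (n + 1, n + 1) \<in> AG" using top x by simp
    show "U (r, k) = None" if "r \<in> {i<..n}" "U (r, r) \<notin> AG" "k < r" for r k
      using that by (intro bd) auto
  qed (use i below in auto)
qed

section \<open>A top row of type \<beta>/\<delta>\<close>

lemma insertion_single_bd:
  assumes "Some y \<in> BD" shows "insertion n T (Single y) = T((n + 1, n + 1) \<mapsto> y)"
  using assms by (auto simp: BD_def add_row_def)

lemma add_bd_row_tableau:
  assumes T: "T \<in> staircase_tableaux n" and y: "Some y \<in> BD"
  shows "T((n + 1, n + 1) \<mapsto> y) \<in> staircase_tableaux (n + 1)"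
proof (rule staircase_tableauxI)
  show "1 \<le> k \<and> k \<le> r \<and> r \<le> n + 1" if "(T((n + 1, n + 1) \<mapsto> y)) (r, k) \<noteq> None" for r k
    using that tableau_dom[OF T, of r k] by (auto split: if_splits)
  show "(T((n + 1, n + 1) \<mapsto> y)) (r, r) \<noteq> None" if "1 \<le> r" "r \<le> n + 1" for r
    using that tableau_diag[OF T, of r] by auto
  show "(T((n + 1, n + 1) \<mapsto> y)) (r', k) = None"
    if "(T((n + 1, n + 1) \<mapsto> y)) (r, k) \<in> AG" "r < r'" "r' \<le> n + 1" "k \<le> r" for r k r'
    using that tableau_column[OF T, of r k r'] by (auto split: if_splits)
  show "(T((n + 1, n + 1) \<mapsto> y)) (r, k') = None"
    if "(T((n + 1, n + 1) \<mapsto> y)) (r, k) \<in> BD" "k' < k" "k \<le> r" "r \<le> n + 1" for r k k'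
    using that tableau_row[OF T, of r k k'] tableau_dom[OF T, of r k'] by (force split: if_splits)
qed

text \<open>The rest of the top row is empty, so erasing one label removes the whole row.\<close>

lemma remove_bd_row:
  assumes U: "U \<in> staircase_tableaux (n + 1)" and y: "U (n + 1, n + 1) \<in> BD"
  shows "U((n + 1, n + 1) := None) \<in> staircase_tableaux n"
proof (rule staircase_tableauxI)
  have ne: "r \<noteq> n + 1" if "(U((n + 1, n + 1) := None)) (r, k) \<noteq> None" for r k
    using that tableau_row[OF U y, of k] tableau_dom[OF U, of r k] by (auto split: if_splits)
  show "1 \<le> k \<and> k \<le> r \<and> r \<le> n" if "(U((n + 1, n + 1) := None)) (r, k) \<noteq> None" for r k
    using that ne[OF that] tableau_dom[OF U, of r k] by (auto split: if_splits)
  show "(U((n + 1, n + 1) := None)) (r, r) \<noteq> None" if "1 \<le> r" "r \<le> n" for r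
    using that tableau_diag[OF U, of r] by auto
  show "(U((n + 1, n + 1) := None)) (r', k) = None"
    if "(U((n + 1, n + 1) := None)) (r, k) \<in> AG" "r < r'" for r k r'
    using that tableau_column[OF U, of r k r'] by (auto split: if_splits)
  show "(U((n + 1, n + 1) := None)) (r, k') = None"
    if "(U((n + 1, n + 1) := None)) (r, k) \<in> BD" "k' < k" for r k k'
    using that tableau_row[OF U, of r k k'] by (auto split: if_splits)
qed

section \<open>Bijectivity\<close>

lemma insertion_tableau:
  assumes T: "T \<in> staircase_tableaux n" and e: "e \<in> insertion_elts n"
  shows "insertion n T e \<in> staircase_tableaux (n + 1)"
  using e
proof (cases rule: insertion_elts_cases)
  case (1 y)
  then show ?thesis using add_bd_row_tableau[OF T] insertion_single_bd by simp
next
  case (2 x y i)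
  then show ?thesis using shifted_tableau[OF insertion_shifted(1)[OF T] T] by simp
qed

text \<open>The type of the new diagonal label separates the two kinds of insertion. For those with
  a shift, the result determines first the index, then the source, then the labels.\<close>

lemma insertion_inj:
  assumes T: "T \<in> staircase_tableaux n" "T' \<in> staircase_tableaux n"
    and e: "e \<in> insertion_elts n" "e' \<in> insertion_elts n"
    and eq: "insertion n T e = insertion n T' e'"
  shows "T = T' \<and> e = e'"
  using e(1)
proof (cases rule: insertion_elts_cases)
  case e1: (1 y)
  then have U: "insertion n T e = T((n + 1, n + 1) \<mapsto> y)" using insertion_single_bd by simp
  show ?thesis using e(2)
  proof (cases rule: insertion_elts_cases)
    case (1 y')
    then have U': "T((n + 1, n + 1) \<mapsto> y) = T'((n + 1, n + 1) \<mapsto> y')"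
      using insertion_single_bd U eq by metis
    have "T (n + 1, n + 1) = None" "T' (n + 1, n + 1) = None"
      using tableau_dom[OF T(1), of "n + 1" "n + 1"] tableau_dom[OF T(2), of "n + 1" "n + 1"] by force+
    then have "T = T'" "y = y'" using U' by (metis fun_upd_idem_iff fun_upd_upd, metis map_upd_eqD1)
    then show ?thesis using 1 e1 by simp
  next
    case (2 x' y' i')
    then show ?thesis using insertion_shifted(2)[OF T(2) 2(2-4)] U eq e1(2) AG_BD_disjoint by auto
  qed
next
  case e1: (2 x y i)
  note U = insertion_shifted[OF T(1) e1(2-4)]
  show ?thesis using e(2)
  proof (cases rule: insertion_elts_cases)
    case (1 y')
    then show ?thesis using U(2) insertion_single_bd eq e1(1,2) AG_BD_disjoint by auto
  next
    case (2 x' y' i')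
    note U' = insertion_shifted[OF T(2) 2(2-4)]
    have eq': "insertion n T (insertion_elt x y i) = insertion n T' (insertion_elt x' y' i')"
      using eq 2 e1 by simp
    have i: "i = i'" using shifted_index_unique[OF U(1) _ T] U'(1) eq' by simp
    have "T = T'" using shifted_source_unique[OF U(1) _ T] U'(1) eq' i by simp
    moreover have "insertion_elt x y i = insertion_elt x' y' i'"
      using U(2,3) U'(2,3) eq' i by (auto simp: insertion_elt_def)
    ultimately show ?thesis using 2 e1 by simp
  qed
qed

text \<open>For a top label in \<open>AG\<close>, \<open>unshift\<close> supplies \<open>i\<close>
  and \<open>T\<close>, and the labels are read off the diagonal. Both \<open>U\<close> and the
  insertion are then related to \<open>T\<close> by \<open>shifted\<close>, so they
  coincide.\<close>

lemma insertion_surj: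
  assumes U: "U \<in> staircase_tableaux (n + 1)"
  obtains T e where "T \<in> staircase_tableaux n" "e \<in> insertion_elts n" "insertion n T e = U"
proof (cases "U (n + 1, n + 1) \<in> AG")
  case False
  then have bd: "U (n + 1, n + 1) \<in> BD" using tableau_diag_cases[OF U, of "n + 1"] by simp
  then obtain y where y: "U (n + 1, n + 1) = Some y" "Some y \<in> BD" by (auto simp: BD_def)
  have "Single y \<in> insertion_elts n" by (cases y) (auto simp: insertion_elts_def)
  moreover have "insertion n (U((n + 1, n + 1) := None)) (Single y) = U"
    using insertion_single_bd y by auto
  ultimately show ?thesis using that remove_bd_row[OF U bd] by blast
next
  case top: True
  then obtain i T where T: "T \<in> staircase_tableaux n" "shifted n i T U" using unshift[OF U] by blast
  obtain x where x: "U (n + 1, n + 1) = Some x" "Some x \<in> AG" using top by (auto simp: AG_def)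
  \<comment> \<open>For \<open>i = 0\<close> any \<open>y\<close> with
    \<open>Some y \<in> BD\<close> will do.\<close>
  obtain y where y: "i \<noteq> 0 \<Longrightarrow> U (i, i) = Some y" "Some y \<in> BD"
    using shifted_index_bd[OF T(2)] by (cases "i = 0") (auto simp: BD_def)
  note i = shifted_index_le[OF T(2)]
  note ins = insertion_shifted[OF T(1) x(2) y(2) i]
  have "insertion n T (insertion_elt x y i) = U"
    using shifted_target_unique[OF ins(1) T(2)] ins(2,3) x y by simp
  then show ?thesis using that T(1) insertion_elt_mem[OF x(2) y(2) i] by blast
qed

theorem theorem6:
  fixes n :: nat
  assumes "n \<ge> 1"
  shows "bij_betw (\<lambda>(T, e). insertion n T e)
           (staircase_tableaux n \<times> insertion_elts n) (staircase_tableaux (n + 1))"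
proof (rule bij_betw_imageI)
  show "inj_on (\<lambda>(T, e). insertion n T e) (staircase_tableaux n \<times> insertion_elts n)"
    by (rule inj_onI) (auto dest: insertion_inj)
  show "(\<lambda>(T, e). insertion n T e) ` (staircase_tableaux n \<times> insertion_elts n)
      = staircase_tableaux (n + 1)"
  proof (intro equalityI subsetI)
    fix U assume "U \<in> staircase_tableaux (n + 1)"
    then obtain T e where "T \<in> staircase_tableaux n" "e \<in> insertion_elts n" "insertion n T e = U"
      using insertion_surj by blast
    then show "U \<in> (\<lambda>(T, e). insertion n T e) ` (staircase_tableaux n \<times> insertion_elts n)"
      by force
  qed (auto intro: insertion_tableau[simplified])
qed

end
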